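(* Let $A \subseteq \{1,3,5,\ldots\}$ and $B \subseteq \{2,4,6,\ldots\}$ with $1 \in A$. Define $(c_n)_{n \ge 0}$ by $$\left(1-\sum_{a \in A} \frac{x^a}{a!} + \sum_{b \in B} \frac{x^b}{b!}\right)^{-1} = \sum_{n \ge 0} c_n \frac{x^n}{n!}.$$ If the smallest element of $\{1,2,3,\ldots\}\setminus(A\cup B)$ exists and equals $2m+1$ for an integer $m$, then $c_{2m+2}<0$.
   Context: All series are formal power series in $x$; $A$ and $B$ may be finite or infinite. *)

theory Defs
  imports "HOL-Computational_Algebra.Formal_Power_Series"
begin

text \<open>
  The formal series \<open>\<Sum>s\<in>S. x^s / s!\<close>. The set \<open>S\<close> may be infinite, so the sum is
  given by its coefficients; \<open>exp_series_on_sums\<close> shows that it is the limit of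
  the finite partial sums.
\<close>

definition exp_series_on :: "nat set \<Rightarrow> real fps" where
  "exp_series_on S = Abs_fps (\<lambda>n. if n \<in> S then 1 / fact n else 0)"

lemma exp_series_on_sums:
  "(\<lambda>N. \<Sum>s\<in>S \<inter> {0..N}. fps_const (1 / fact s) * fps_X ^ s) \<longlonglongrightarrow> exp_series_on S"
proof -
  have "(\<Sum>s\<in>S \<inter> {0..N}. fps_const (1 / fact s) * fps_X ^ s) =
    (\<Sum>i = 0..N. fps_const (fps_nth (exp_series_on S) i) * fps_X ^ i)" for N
    by (rule sum.mono_neutral_cong_left) (auto simp: exp_series_on_def)
  then show ?thesis
    using fps_notation[of "exp_series_on S"] by simp
qed

end

theory Submission
  imports Defs
begin

text \<open>
  Put \<open>N = 2m + 1\<close>. Up to order \<open>N - 1\<close> the denominator agrees with \<open>e\<^sup>-\<^sup>x\<close>, so it is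
  \<open>e\<^sup>-\<^sup>x + x\<^sup>N G\<close> with \<open>G = 1/N! - \<epsilon> x/(N+1)! + \<dots>\<close>, where \<open>\<epsilon> = 0\<close> if \<open>N + 1 \<in> B\<close> and
  \<open>\<epsilon> = 1\<close> otherwise. Multiplying by \<open>e\<^sup>x\<close>, its inverse \<open>I\<close> satisfies \<open>I + x\<^sup>N I G e\<^sup>x = e\<^sup>x\<close>;
  since \<open>1 \<in> A\<close> forces \<open>N \<ge> 3\<close>, comparing coefficients gives
  \<open>c\<^sub>N\<^sub>+\<^sub>1 = 1 + \<epsilon> - 2(N + 1) < 0\<close>.
\<close>

lemma fps_nth_inverse_perturbed_exp:
  fixes F G :: "real fps"
  assumes F: "F = fps_exp (- 1) + fps_X ^ N * G" and N: "N \<ge> 2"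
  shows "fps_nth (inverse F) (Suc N) = 1 / fact (Suc N) - 2 * fps_nth G 0 - fps_nth G 1"
proof -
  let ?E = "fps_exp 1 :: real fps" and ?I = "inverse F"
  have "fps_nth F 0 \<noteq> 0"
    using N by (simp add: F fps_X_power_mult_nth)
  then have "?I * F = 1"
    by (rule inverse_mult_eq_1)
  moreover have "?E * F = 1 + fps_X ^ N * (?E * G)"
    using fps_exp_add_mult[of "1 :: real" "- 1"] by (simp add: F algebra_simps)
  moreover have "?I * (?E * F) = ?E * (?I * F)"
    by (rule mult.left_commute)
  ultimately have E: "?I + fps_X ^ N * (?I * (?E * G)) = ?E"
    by (simp add: distrib_left mult.left_commute[of ?I])
  have nth: "fps_nth ?I n + (if n < N then 0 else fps_nth (?I * (?E * G)) (n - N)) = 1 / fact n" for n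
    using arg_cong[OF E, of "\<lambda>f. fps_nth f n"] by (simp add: fps_X_power_mult_nth)
  have "fps_nth ?I 0 = 1" "fps_nth ?I 1 = 1"
    using nth[of 0] nth[of 1] N by simp_all
  \<comment> \<open>Both \<open>?I\<close> and \<open>?E\<close> begin with 1 + x, so their product
    begins with 1 + 2x; hence the factor 2.\<close>
  then have "fps_nth (?I * (?E * G)) 1 = 2 * fps_nth G 0 + fps_nth G 1"
    by (simp add: fps_mult_nth)
  with nth[of "Suc N"] show ?thesis
    by simp
qed

theorem theorem1p6:
  fixes A B :: "nat set" and c :: "nat \<Rightarrow> real" and m :: nat
  assumes "A \<subseteq> {n. odd n}"
    and "B \<subseteq> {n. even n \<and> n > 0}"
    and "1 \<in> A"
    and "inverse (1 - exp_series_on A + exp_series_on B) = Abs_fps (\<lambda>n. c n / fact n)"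
    and "{1..} - (A \<union> B) \<noteq> {}"
    and "(LEAST k. k \<in> {1..} - (A \<union> B)) = 2 * m + 1"
  shows "c (2 * m + 2) < 0"
proof -
  define N where "N = 2 * m + 1"
  define F where "F = 1 - exp_series_on A + exp_series_on B"
  define G where "G = fps_shift N (F - fps_exp (- 1))"
  have least: "(LEAST k. k \<in> {1..} - (A \<union> B)) = N"
    using assms(6) by (simp add: N_def)
  have missing: "N \<notin> A \<union> B"
    using LeastI_ex[of "\<lambda>k. k \<in> {1..} - (A \<union> B)"] assms(5) unfolding least by blast
  have below: "k \<in> A \<union> B" if "1 \<le> k" "k < N" for k
    using not_less_Least[of k "\<lambda>k. k \<in> {1..} - (A \<union> B)"] that unfolding least by auto
  \<comment> \<open>For \<open>m = 0\<close> the missing number would be 1, which lies in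
    \<open>A\<close>.\<close>
  have "m \<noteq> 0"
    using missing assms(3) by (intro notI) (simp add: N_def)
  then have N: "N \<ge> 2"
    by (simp add: N_def)
  have F_nth: "fps_nth F k = (if k = 0 then 1 else if k \<in> A then - 1 / fact k
      else if k \<in> B then 1 / fact k else 0)" for k
    using assms(1,2) by (auto simp: F_def exp_series_on_def)
  have "fps_nth F k = (- 1) ^ k / fact k" if "k < N" for k
    using below[of k] that assms(1,2) by (cases "k = 0") (auto simp: F_nth)
  then have F: "F = fps_exp (- 1) + fps_X ^ N * G"
    by (auto simp: fps_eq_iff fps_X_power_mult_nth G_def)
  have "odd N"
    by (simp add: N_def)
  \<comment> \<open>At order \<open>N\<close>, \<open>F\<close> has coefficient 0 and exp(-x) has
    -1/N!, as \<open>N\<close> is odd.\<close>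
  then have "Suc N \<notin> A" "fps_nth G 0 = 1 / fact N"
    using assms(1) missing N by (auto simp: G_def F_nth simp del: fact_Suc)
  \<comment> \<open>At the even order \<open>Suc N\<close>, exp(-x) has coefficient 1/(N+1)! and
    \<open>F\<close> has the same or 0, the latter if \<open>Suc N\<close> is not in
    \<open>B\<close>.\<close>
  moreover from this(1) have "fps_nth G 1 \<ge> - 1 / fact (Suc N)"
    using \<open>odd N\<close> by (simp add: G_def F_nth del: fact_Suc)
  ultimately have "c (Suc N) / fact (Suc N) \<le> 2 / fact (Suc N) - 2 / fact N"
    using fps_nth_inverse_perturbed_exp[OF F N] assms(4) by (simp add: F_def del: fact_Suc)
  also have "\<dots> = - 2 * real N / fact (Suc N)"
    by (simp add: divide_simps)
  finally have "c (Suc N) \<le> - 2 * real N"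
    by (simp only: divide_le_cancel fact_gt_zero simp_thms)
  then show ?thesis
    using N by (simp add: N_def)
qed

end
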